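(* If $(S_1,A_1)$ and $(S_2,A_2)$ are isomorphic physical models, then $(S_1,A_1)$ and $(S_2,A_2)$ are observationally equivalent.
   Context: A physical model is a pair $(S,A)$ where $S$ is a set (of states) and $A$ is a set of functions from $S$ to the real numbers (observable quantities). $(S,A)$ and $(T,B)$ are isomorphic iff there exist bijections $\phi:S\to T$ and $\psi:A\to B$ with $\alpha(s)=\psi(\alpha)(\phi(s))$ for all $s\in S$, $\alpha\in A$. $(S,A)$ is reduced iff for all distinct $s_1,s_2\in S$ there is $\alpha\in A$ with $\alpha(s_1)\ne\alpha(s_2)$. An epimorphism from $(S,A)$ to $(T,B)$ is a pair $(\phi,\psi)$ with $\phi:S\to T$ a surjection and $\psi:A\to B$ a bijection such that $\alpha(s)=\psi(\alpha)(\phi(s))$ for all $s\in S$, $\alpha\in A$. Two physical models $(S_1,A_1)$, $(S_2,A_2)$ are observationally equivalent iff there is a reduced physical model $(T,B)$ with epimorphisms from $(S_1,A_1)$ to $(T,B)$ and from $(S_2,A_2)$ to $(T,B)$. *)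

theory Defs
  imports Complex_Main "HOL-Library.FuncSet"
begin

text \<open>
  A real-valued function whose domain is the set \<open>S\<close> is represented by the total function that
  takes the value \<open>undefined\<close> outside \<open>S\<close> (\<open>S \<rightarrow>\<^sub>E UNIV\<close>), so that two observables are equal iff they
  agree on all states of the model.
\<close>

definition physical_model :: "'a set \<Rightarrow> ('a \<Rightarrow> real) set \<Rightarrow> bool" where
  "physical_model S A \<longleftrightarrow> A \<subseteq> S \<rightarrow>\<^sub>E UNIV"

definition isomorphic ::
  "'a set \<Rightarrow> ('a \<Rightarrow> real) set \<Rightarrow> 'b set \<Rightarrow> ('b \<Rightarrow> real) set \<Rightarrow> bool" where
  "isomorphic S A T B \<longleftrightarrow>
     (\<exists>\<phi> \<psi>. bij_betw \<phi> S T \<and> bij_betw \<psi> A B \<and> (\<forall>s\<in>S. \<forall>\<alpha>\<in>A. \<alpha> s = \<psi> \<alpha> (\<phi> s)))"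

definition reduced :: "'a set \<Rightarrow> ('a \<Rightarrow> real) set \<Rightarrow> bool" where
  "reduced S A \<longleftrightarrow> (\<forall>s\<^sub>1\<in>S. \<forall>s\<^sub>2\<in>S. s\<^sub>1 \<noteq> s\<^sub>2 \<longrightarrow> (\<exists>\<alpha>\<in>A. \<alpha> s\<^sub>1 \<noteq> \<alpha> s\<^sub>2))"

definition epimorphism ::
  "'a set \<Rightarrow> ('a \<Rightarrow> real) set \<Rightarrow> 'b set \<Rightarrow> ('b \<Rightarrow> real) set
    \<Rightarrow> ('a \<Rightarrow> 'b) \<Rightarrow> (('a \<Rightarrow> real) \<Rightarrow> ('b \<Rightarrow> real)) \<Rightarrow> bool" where
  "epimorphism S A T B \<phi> \<psi> \<longleftrightarrow>
     \<phi> ` S = T \<and> bij_betw \<psi> A B \<and> (\<forall>s\<in>S. \<forall>\<alpha>\<in>A. \<alpha> s = \<psi> \<alpha> (\<phi> s))"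

text \<open>
  The common reduced image \<open>(T, B)\<close> may be any physical model, but an existential quantifier cannot
  range over types, so its states are taken from the state type of the first model. This loses
  nothing, because \<open>T\<close> is an image of \<open>S\<^sub>1\<close>: the lemma \<open>observationally_equivalentI\<close> below shows that
  a common reduced image with states of an arbitrary type is enough.
\<close>

definition observationally_equivalent ::
  "'a set \<Rightarrow> ('a \<Rightarrow> real) set \<Rightarrow> 'b set \<Rightarrow> ('b \<Rightarrow> real) set \<Rightarrow> bool" where
  "observationally_equivalent S\<^sub>1 A\<^sub>1 S\<^sub>2 A\<^sub>2 \<longleftrightarrow>
     (\<exists>(T :: 'a set) B. physical_model T B \<and> reduced T B \<and>
        (\<exists>\<phi> \<psi>. epimorphism S\<^sub>1 A\<^sub>1 T B \<phi> \<psi>) \<and>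
        (\<exists>\<phi> \<psi>. epimorphism S\<^sub>2 A\<^sub>2 T B \<phi> \<psi>))"

lemma observationally_equivalentI:
  fixes S\<^sub>1 :: "'a set" and S\<^sub>2 :: "'b set" and T :: "'c set"
  assumes pm: "physical_model T B" and red: "reduced T B"
    and e1: "epimorphism S\<^sub>1 A\<^sub>1 T B \<phi>\<^sub>1 \<psi>\<^sub>1" and e2: "epimorphism S\<^sub>2 A\<^sub>2 T B \<phi>\<^sub>2 \<psi>\<^sub>2"
  shows "observationally_equivalent S\<^sub>1 A\<^sub>1 S\<^sub>2 A\<^sub>2"
proof -
  define g where "g = inv_into S\<^sub>1 \<phi>\<^sub>1"
  define T' where "T' = g ` T"
  define h where "h = (\<lambda>\<beta>. restrict (\<lambda>x. \<beta> (\<phi>\<^sub>1 x)) T' :: 'a \<Rightarrow> real)"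
  have fg: "\<phi>\<^sub>1 (g t) = t" if "t \<in> T" for t
    using e1 that by (auto simp: g_def epimorphism_def intro: f_inv_into_f)
  have h: "h \<beta> (g t) = \<beta> t" if "t \<in> T" for \<beta> t
    using that fg by (auto simp: h_def T'_def)
  have inj: "inj_on h B"
  proof (rule inj_onI)
    fix b c assume bc: "b \<in> B" "c \<in> B" "h b = h c"
    have "b t = c t" if "t \<in> T" for t
      using h[OF that] bc(3) by metis
    then show "b = c"
      using bc(1,2) pm unfolding physical_model_def
      by (meson PiE_ext subsetD)
  qed
  have bij: "bij_betw h B (h ` B)"
    using inj by (simp add: bij_betw_def)
  have pm': "physical_model T' (h ` B)"
    by (auto simp: physical_model_def h_def)
  have red': "reduced T' (h ` B)"
    unfolding reduced_def
  proof (intro ballI impI)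
    fix x y assume "x \<in> T'" "y \<in> T'" "x \<noteq> y"
    then obtain t u where tu: "t \<in> T" "u \<in> T" "t \<noteq> u" "x = g t" "y = g u"
      by (auto simp: T'_def)
    then obtain b where "b \<in> B" "b t \<noteq> b u"
      using red by (auto simp: reduced_def)
    then show "\<exists>\<alpha>\<in>h ` B. \<alpha> x \<noteq> \<alpha> y"
      using tu h by auto
  qed
  have epi1: "epimorphism S\<^sub>1 A\<^sub>1 T' (h ` B) (g \<circ> \<phi>\<^sub>1) (h \<circ> \<psi>\<^sub>1)"
    using e1 h bij_betw_trans[OF _ bij] by (auto simp: epimorphism_def T'_def)
  have epi2: "epimorphism S\<^sub>2 A\<^sub>2 T' (h ` B) (g \<circ> \<phi>\<^sub>2) (h \<circ> \<psi>\<^sub>2)"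
    using e2 h bij_betw_trans[OF _ bij] by (auto simp: epimorphism_def T'_def)
  show ?thesis
    unfolding observationally_equivalent_def
    using pm' red' epi1 epi2 by blast
qed

end

theory Submission
  imports Defs
begin

text \<open>
  Choosing one state from each class of observationally indistinguishable states yields a reduced
  quotient of the first model. It is also an image of the second one, through the inverse of
  the isomorphism.
\<close>

lemma ex_reduced_epimorphic_image:
  fixes S :: "'a set"
  assumes pm: "physical_model S A"
  obtains T :: "'a set" and B \<phi> \<psi>
  where "physical_model T B" "reduced T B" "epimorphism S A T B \<phi> \<psi>"
proof -
  \<comment> \<open>\<open>r\<close> picks a representative inside \<open>S\<close>, so the quotient
    \<open>T\<close> is a set of states of the same type and its observables are plain restrictions.
    State \<open>s\<close> itself witnesses the choice.\<close>
  define r where "r s = (SOME t. t \<in> S \<and> (\<forall>\<alpha>\<in>A. \<alpha> t = \<alpha> s))" for s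
  define T where "T = r ` S"
  define res where "res \<alpha> = restrict \<alpha> T" for \<alpha> :: "'a \<Rightarrow> real"
  have r: "r s \<in> S \<and> (\<forall>\<alpha>\<in>A. \<alpha> (r s) = \<alpha> s)" if "s \<in> S" for s
    unfolding r_def by (rule someI[where x = s]) (use that in simp)
  \<comment> \<open>The predicate under \<open>SOME\<close> mentions \<open>s\<close> only through
    the values \<alpha> s with \<alpha> in \<open>A\<close>; indistinguishable states give equal
    predicates, hence the same choice.\<close>
  have r_cong: "r s = r s'" if "\<forall>\<alpha>\<in>A. \<alpha> s = \<alpha> s'" for s s'
    unfolding r_def by (rule arg_cong[where f = Eps]) (use that in \<open>auto simp: fun_eq_iff\<close>)
  have res: "res \<alpha> (r s) = \<alpha> s" if "s \<in> S" "\<alpha> \<in> A" for s \<alpha>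
    using that r by (simp add: res_def T_def)
  \<comment> \<open>No information is lost by restricting: the value at \<open>s\<close> can be read
    off at \<open>r s\<close>. Outside \<open>S\<close> both observables are
    \<open>undefined\<close>, so agreement on \<open>S\<close> gives equality.\<close>
  have "inj_on res A"
  proof (rule inj_onI)
    fix \<alpha> \<beta> assume *: "\<alpha> \<in> A" "\<beta> \<in> A" "res \<alpha> = res \<beta>"
    then have "\<alpha> s = \<beta> s" if "s \<in> S" for s
      using res[OF that] by metis
    then show "\<alpha> = \<beta>"
      using * pm unfolding physical_model_def by (meson PiE_ext subsetD)
  qed
  then have "epimorphism S A T (res ` A) r res"
    using res by (simp add: epimorphism_def T_def bij_betw_def)
  moreover have "reduced T (res ` A)"
    unfolding reduced_def
  proof (intro ballI impI)
    fix x y assume "x \<in> T" "y \<in> T" "x \<noteq> y"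
    then obtain s s' where s: "s \<in> S" "s' \<in> S" "x = r s" "y = r s'" "r s \<noteq> r s'"
      by (auto simp: T_def)
    \<comment> \<open>Contrapositive of \<open>r_cong\<close>: different representatives come from
      distinguishable states.\<close>
    then obtain \<alpha> where "\<alpha> \<in> A" "\<alpha> s \<noteq> \<alpha> s'"
      using r_cong by blast
    then show "\<exists>\<beta>\<in>res ` A. \<beta> x \<noteq> \<beta> y"
      using s res by auto
  qed
  moreover have "physical_model T (res ` A)"
    by (auto simp: physical_model_def res_def)
  ultimately show thesis using that by blast
qed

text \<open>The direction is reversed because the quotient is built from the first model, so the
  second has to be mapped onto the first.\<close>

lemma isomorphic_imp_epimorphism_inverse:
  assumes "isomorphic S A T B"
  obtains \<phi> \<psi> where "epimorphism T B S A \<phi> \<psi>"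
proof -
  obtain f g where f: "bij_betw f S T" and g: "bij_betw g A B"
    and fg: "\<And>s \<alpha>. s \<in> S \<Longrightarrow> \<alpha> \<in> A \<Longrightarrow> \<alpha> s = g \<alpha> (f s)"
    using assms unfolding isomorphic_def by blast
  \<comment> \<open>The compatibility of \<open>f\<close> and \<open>g\<close>, taken at the
    preimages of \<open>t\<close> and \<beta>, read from right to left.\<close>
  have "\<beta> t = inv_into A g \<beta> (inv_into S f t)" if "t \<in> T" "\<beta> \<in> B" for t \<beta>
    using fg[of "inv_into S f t" "inv_into A g \<beta>"] that
      bij_betw_inv_into_right[OF f] bij_betw_inv_into_right[OF g]
      bij_betw_apply[OF bij_betw_inv_into[OF f]] bij_betw_apply[OF bij_betw_inv_into[OF g]]
    by simp
  then have "epimorphism T B S A (inv_into S f) (inv_into A g)"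
    using bij_betw_inv_into[OF f] bij_betw_inv_into[OF g]
    by (simp add: epimorphism_def bij_betw_imp_surj_on)
  then show thesis by (rule that)
qed

lemma epimorphism_comp:
  assumes "epimorphism S A T B \<phi> \<psi>" "epimorphism T B U C \<phi>' \<psi>'"
  shows "epimorphism S A U C (\<phi>' \<circ> \<phi>) (\<psi>' \<circ> \<psi>)"
  \<comment> \<open>\<open>bij_betw_apply\<close> places \<psi> \<alpha> in \<open>B\<close>, where
    the compatibility of the second epimorphism applies.\<close>
  using assms bij_betw_trans[of \<psi> A B \<psi>' C] bij_betw_apply[of \<psi> A B]
  by (auto simp: epimorphism_def)

theorem theorem6:
  fixes S\<^sub>1 :: "'a set" and A\<^sub>1 :: "('a \<Rightarrow> real) set"
    and S\<^sub>2 :: "'b set" and A\<^sub>2 :: "('b \<Rightarrow> real) set"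
  assumes "physical_model S\<^sub>1 A\<^sub>1" and "physical_model S\<^sub>2 A\<^sub>2"
    and "isomorphic S\<^sub>1 A\<^sub>1 S\<^sub>2 A\<^sub>2"
  shows "observationally_equivalent S\<^sub>1 A\<^sub>1 S\<^sub>2 A\<^sub>2"
proof -
  obtain T :: "'a set" and B \<phi> \<psi> where T: "physical_model T B" "reduced T B"
    and e1: "epimorphism S\<^sub>1 A\<^sub>1 T B \<phi> \<psi>"
    using ex_reduced_epimorphic_image[OF assms(1)] .
  obtain \<phi>' \<psi>' where "epimorphism S\<^sub>2 A\<^sub>2 S\<^sub>1 A\<^sub>1 \<phi>' \<psi>'"
    using isomorphic_imp_epimorphism_inverse[OF assms(3)] .
  from epimorphism_comp[OF this e1] show ?thesis
    by (rule observationally_equivalentI[OF T e1])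
qed

end
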